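(* Let $\lVert\cdot\rVert_A$ and $\lVert\cdot\rVert_B$ be rearrangement-invariant Banach function norms over $([0,\infty),\lambda)$, with corresponding Banach function spaces $A$ and $B$. Then $$A\cap B\hookrightarrow WL(A,B)\hookrightarrow A+B.$$
   Context: $\lambda$ is Lebesgue measure on $[0,\infty)$; $M$ is the set of extended complex-valued $\lambda$-measurable functions on $[0,\infty)$ (identified when equal a.e.), $M_+$ the non-negative ones. The non-increasing rearrangement of $f\in M$ is $f^*(t)=\inf\{s\ge 0:\lambda(\{|f|>s\})\le t\}$. A Banach function norm is a map $\lVert\cdot\rVert:M\to[0,\infty]$ with $\lVert\,|f|\,\rVert=\lVert f\rVert$ whose restriction to $M_+$ satisfies: (P1) it is positively homogeneous, $\lVert f\rVert=0\Leftrightarrow f=0$ a.e., and $\lVert f+g\rVert\le\lVert f\rVert+\lVert g\rVert$; (P2) $f\le g$ a.e. implies $\lVert f\rVert\le\lVert g\rVert$; (P3) $f_n\uparrow f$ a.e. implies $\lVert f_n\rVert\uparrow\lVert f\rVert$; (P4) $\lVert\chi_E\rVert<\infty$ whenever $\lambda(E)<\infty$; (P5) for every $E$ with $\lambda(E)<\infty$ there is a finite $C_E$ with $\int_E f\,d\lambda\le C_E\lVert f\rVert$ for all $f\in M_+$. It is rearrangement-invariant (r.i.) if $f^*=g^*$ implies $\lVert f\rVert=\lVert g\rVert$. The corresponding Banach function space is $X=\{f\in M:\lVert f\rVert_X<\infty\}$ (its elements are finite a.e.). $\lVert f\rVert_{WL(A,B)}=\lVert f^*\chi_{[0,1]}\rVert_A+\lVert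 f^*\chi_{(1,\infty)}\rVert_B$ for $f\in M$, and $WL(A,B)=\{f\in M:\lVert f\rVert_{WL(A,B)}<\infty\}$. $A\cap B$ carries the norm $\max\{\lVert f\rVert_A,\lVert f\rVert_B\}$; $A+B=\{g+h:g\in A,h\in B\}$ carries the norm $\lVert f\rVert_{A+B}=\inf\{\lVert g\rVert_A+\lVert h\rVert_B: g\in A,h\in B,g+h=f\}$. $Y\hookrightarrow X$ means $Y\subseteq X$ and the identity $Y\to X$ is continuous, i.e. $\lVert f\rVert_X\le K\lVert f\rVert_Y$ for all $f\in Y$ with some finite constant $K$. *)

theory Defs
  imports "HOL-Analysis.Analysis"
begin

abbreviation halfline :: "real measure" where
  "halfline \<equiv> lebesgue_on {0..}"

text \<open>Extended complex numbers: the one-point compactification of the complex plane.\<close>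

datatype ecomplex = FinC complex | InfC

text \<open>The Borel sigma-algebra of the Riemann sphere; the point at infinity is measurable as the
  complement of the image of the whole plane.\<close>

definition ecomplex_borel :: "ecomplex measure" where
  "ecomplex_borel = sigma UNIV {FinC ` U |U. open U}"

fun ec_abs :: "ecomplex \<Rightarrow> ennreal" where
  "ec_abs (FinC z) = ennreal (cmod z)"
| "ec_abs InfC = \<infinity>"

text \<open>The value of a sum with an infinite term is immaterial: it is only used for functions that
  are finite almost everywhere.\<close>

fun ec_add :: "ecomplex \<Rightarrow> ecomplex \<Rightarrow> ecomplex" where
  "ec_add (FinC z) (FinC w) = FinC (z + w)"
| "ec_add _ _ = InfC"

definition ec_of_ennreal :: "ennreal \<Rightarrow> ecomplex" where
  "ec_of_ennreal r = (if r = \<infinity> then InfC else FinC (complex_of_real (enn2real r)))"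

text \<open>Functions are total on the reals; values at negative arguments are ignored, and elements of
  M are representatives, identification almost everywhere being expressed through \<open>AE\<close>.\<close>

definition M_space :: "(real \<Rightarrow> ecomplex) set" where
  "M_space = measurable halfline ecomplex_borel"

text \<open>Non-negative elements of M are handled as functions with values in \<open>ennreal\<close>,
  and enter M through this embedding.\<close>

definition nonneg_emb :: "(real \<Rightarrow> ennreal) \<Rightarrow> real \<Rightarrow> ecomplex" where
  "nonneg_emb f = (\<lambda>x. ec_of_ennreal (f x))"

abbreviation M_plus :: "(real \<Rightarrow> ennreal) set" where
  "M_plus \<equiv> borel_measurable halfline"

text \<open>The infimum of the empty set is infinite in \<open>ennreal\<close>.\<close>

definition rearr :: "(real \<Rightarrow> ecomplex) \<Rightarrow> real \<Rightarrow> ennreal" where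
  "rearr f t = Inf {ennreal s |s::real. 0 \<le> s \<and>
     emeasure halfline {x \<in> space halfline. ec_abs (f x) > ennreal s} \<le> ennreal t}"

definition banach_function_norm :: "((real \<Rightarrow> ecomplex) \<Rightarrow> ennreal) \<Rightarrow> bool" where
  "banach_function_norm N \<longleftrightarrow>
     (\<forall>f\<in>M_space. N (nonneg_emb (\<lambda>x. ec_abs (f x))) = N f) \<and>
     (\<forall>f\<in>M_plus. \<forall>a::real. 0 \<le> a \<longrightarrow>
        N (nonneg_emb (\<lambda>x. ennreal a * f x)) = ennreal a * N (nonneg_emb f)) \<and>
     (\<forall>f\<in>M_plus. N (nonneg_emb f) = 0 \<longleftrightarrow> (AE x in halfline. f x = 0)) \<and>
     (\<forall>f\<in>M_plus. \<forall>g\<in>M_plus.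
        N (nonneg_emb (\<lambda>x. f x + g x)) \<le> N (nonneg_emb f) + N (nonneg_emb g)) \<and>
     (\<forall>f\<in>M_plus. \<forall>g\<in>M_plus. (AE x in halfline. f x \<le> g x) \<longrightarrow>
        N (nonneg_emb f) \<le> N (nonneg_emb g)) \<and>
     (\<forall>F f. (\<forall>n::nat. F n \<in> M_plus) \<longrightarrow> f \<in> M_plus \<longrightarrow>
        (AE x in halfline. incseq (\<lambda>n. F n x) \<and> (\<lambda>n. F n x) \<longlonglongrightarrow> f x) \<longrightarrow>
        incseq (\<lambda>n. N (nonneg_emb (F n))) \<and> (\<lambda>n. N (nonneg_emb (F n))) \<longlonglongrightarrow> N (nonneg_emb f)) \<and>
     (\<forall>E\<in>sets halfline. emeasure halfline E < \<infinity> \<longrightarrow> N (nonneg_emb (indicator E)) < \<infinity>) \<and>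
     (\<forall>E\<in>sets halfline. emeasure halfline E < \<infinity> \<longrightarrow>
        (\<exists>C<\<infinity>. \<forall>f\<in>M_plus. (\<integral>\<^sup>+x\<in>E. f x \<partial>halfline) \<le> C * N (nonneg_emb f)))"

definition ri_banach_function_norm :: "((real \<Rightarrow> ecomplex) \<Rightarrow> ennreal) \<Rightarrow> bool" where
  "ri_banach_function_norm N \<longleftrightarrow> banach_function_norm N \<and>
     (\<forall>f\<in>M_space. \<forall>g\<in>M_space. (\<forall>t\<ge>0. rearr f t = rearr g t) \<longrightarrow> N f = N g)"

definition fspace :: "((real \<Rightarrow> ecomplex) \<Rightarrow> ennreal) \<Rightarrow> (real \<Rightarrow> ecomplex) set" where
  "fspace N = {f \<in> M_space. N f < \<infinity>}"

definition WL_norm ::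
  "((real \<Rightarrow> ecomplex) \<Rightarrow> ennreal) \<Rightarrow> ((real \<Rightarrow> ecomplex) \<Rightarrow> ennreal) \<Rightarrow> (real \<Rightarrow> ecomplex) \<Rightarrow> ennreal" where
  "WL_norm A B f =
     A (nonneg_emb (\<lambda>t. rearr f t * indicator {0..1} t)) +
     B (nonneg_emb (\<lambda>t. rearr f t * indicator {1<..} t))"

definition inter_norm ::
  "((real \<Rightarrow> ecomplex) \<Rightarrow> ennreal) \<Rightarrow> ((real \<Rightarrow> ecomplex) \<Rightarrow> ennreal) \<Rightarrow> (real \<Rightarrow> ecomplex) \<Rightarrow> ennreal" where
  "inter_norm A B f = max (A f) (B f)"

definition sum_space ::
  "((real \<Rightarrow> ecomplex) \<Rightarrow> ennreal) \<Rightarrow> ((real \<Rightarrow> ecomplex) \<Rightarrow> ennreal) \<Rightarrow> (real \<Rightarrow> ecomplex) set" where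
  "sum_space A B = {f \<in> M_space. \<exists>g\<in>fspace A. \<exists>h\<in>fspace B.
     AE x in halfline. ec_add (g x) (h x) = f x}"

definition sum_norm ::
  "((real \<Rightarrow> ecomplex) \<Rightarrow> ennreal) \<Rightarrow> ((real \<Rightarrow> ecomplex) \<Rightarrow> ennreal) \<Rightarrow> (real \<Rightarrow> ecomplex) \<Rightarrow> ennreal" where
  "sum_norm A B f = Inf {A g + B h |g h. g \<in> fspace A \<and> h \<in> fspace B \<and>
     (AE x in halfline. ec_add (g x) (h x) = f x)}"

definition cont_embedded ::
  "(real \<Rightarrow> ecomplex) set \<Rightarrow> ((real \<Rightarrow> ecomplex) \<Rightarrow> ennreal) \<Rightarrow>
   (real \<Rightarrow> ecomplex) set \<Rightarrow> ((real \<Rightarrow> ecomplex) \<Rightarrow> ennreal) \<Rightarrow> bool" where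
  "cont_embedded Y NY X NX \<longleftrightarrow> Y \<subseteq> X \<and> (\<exists>K<\<infinity>. \<forall>f\<in>Y. NX f \<le> K * NY f)"

end

theory Submission imports Defs begin

text \<open>The key fact is that \<open>f\<^sup>*\<close> and \<open>|f|\<close> are equidistributed, because \<open>f\<^sup>*(t) \<le> s\<close> holds exactly when
  \<open>\<lambda>{|f| > s} \<le> t\<close>. Hence \<open>A(f) = A(f\<^sup>*)\<close> and \<open>B(f) = B(f\<^sup>*)\<close>, which gives the first embedding with constant 2.
  For the second one, cut \<open>f\<close> at the height \<open>c = f\<^sup>*(1)\<close>, keeping the argument of \<open>f\<close>: the part of
  modulus \<open>(|f| - c)\<^sub>+\<close> is equidistributed with \<open>(f\<^sup>* - c)\<^sub>+ \<le> f\<^sup>* \<chi>\<^bsub>[0,1]\<^esub>\<close>, the part of modulus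
  \<open>min |f| c\<close> with \<open>min f\<^sup>* c \<le> c \<chi>\<^bsub>[0,1]\<^esub> + f\<^sup>* \<chi>\<^bsub>(1,\<infinity>)\<^esub>\<close>, and (P5) bounds
  \<open>c \<le> \<integral>\<^bsub>[0,1]\<^esub> f\<^sup>*\<close> by a multiple of the \<open>A\<close>-norm of \<open>f\<^sup>* \<chi>\<^bsub>[0,1]\<^esub>\<close>.\<close>

section \<open>Measurability on the extended complex plane\<close>

lemma FinC_image_sets: "open U \<Longrightarrow> FinC ` U \<in> sets ecomplex_borel"
  unfolding ecomplex_borel_def by (subst sets_measure_of) auto

lemma space_ecomplex_borel [simp]: "space ecomplex_borel = UNIV"
  by (simp add: ecomplex_borel_def)

lemma InfC_sets: "{InfC} \<in> sets ecomplex_borel"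
proof -
  have "{InfC} = space ecomplex_borel - FinC ` UNIV"
    by (auto intro: ecomplex.exhaust)
  also have "\<dots> \<in> sets ecomplex_borel"
    using FinC_image_sets[of UNIV] by (intro sets.compl_sets) auto
  finally show ?thesis .
qed

lemma measurable_ecomplex_borelI:
  assumes "\<And>U. open U \<Longrightarrow> f -` (FinC ` U) \<inter> space M \<in> sets M"
  shows "f \<in> measurable M ecomplex_borel"
  unfolding ecomplex_borel_def by (rule measurable_measure_of) (use assms in auto)

lemma measurable_ec_abs: "ec_abs \<in> borel_measurable ecomplex_borel"
proof (rule borel_measurableI_greater)
  fix a :: ennreal
  show "{x \<in> space ecomplex_borel. a < ec_abs x} \<in> sets ecomplex_borel"
  proof (cases a)
    case (real r)
    have "{x \<in> space ecomplex_borel. a < ec_abs x} = FinC ` {z. r < cmod z} \<union> {InfC}"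
      (is "?L = ?R")
    proof (rule set_eqI)
      fix x show "x \<in> ?L \<longleftrightarrow> x \<in> ?R"
        by (cases x) (auto simp: real ennreal_less_iff)
    qed
    moreover have "open {z. r < cmod z}" by (intro open_Collect_less continuous_intros)
    ultimately show ?thesis using FinC_image_sets sets.Un[OF _ InfC_sets] by auto
  next
    case top
    then show ?thesis by simp
  qed
qed

lemma ec_abs_ec_of_ennreal [simp]: "ec_abs (ec_of_ennreal r) = r"
  by (cases r) (auto simp: ec_of_ennreal_def)

lemma ec_abs_nonneg_emb [simp]: "ec_abs (nonneg_emb f x) = f x"
  by (simp add: nonneg_emb_def)

lemma measurable_ec_of_ennreal: "ec_of_ennreal \<in> measurable borel ecomplex_borel"
proof (rule measurable_ecomplex_borelI)
  fix U :: "complex set" assume "open U"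
  then have [measurable]: "U \<in> sets borel" by simp
  have "ec_of_ennreal -` (FinC ` U) \<inter> space borel
      = {r. r \<noteq> \<infinity> \<and> complex_of_real (enn2real r) \<in> U}"
    by (auto simp: ec_of_ennreal_def split: if_splits)
  also have "\<dots> \<in> sets borel" by measurable
  finally show "ec_of_ennreal -` (FinC ` U) \<inter> space borel \<in> sets borel" .
qed

lemma nonneg_emb_in_M_space: "f \<in> M_plus \<Longrightarrow> nonneg_emb f \<in> M_space"
  unfolding M_space_def nonneg_emb_def
  by (rule measurable_compose[OF _ measurable_ec_of_ennreal])

lemma ec_abs_in_M_plus: "f \<in> M_space \<Longrightarrow> (\<lambda>x. ec_abs (f x)) \<in> M_plus"
  unfolding M_space_def by (rule measurable_compose[OF _ measurable_ec_abs])

lemma indicator_in_M_plus: "I \<in> sets borel \<Longrightarrow> indicator I \<in> M_plus"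
  by (intro measurable_restrict_space1 borel_measurable_indicator) auto

text \<open>Needed for the measurability of the two pieces of a function cut at a height. The value
  \<open>v\<close> at infinity is free because \<open>{InfC}\<close> is a measurable set, so
  continuity matters only on the finite plane.\<close>

lemma measurable_case_ecomplex_continuous:
  assumes "continuous_on UNIV p"
  shows "case_ecomplex (\<lambda>z. FinC (p z)) v \<in> measurable ecomplex_borel ecomplex_borel"
proof (rule measurable_ecomplex_borelI)
  fix U :: "complex set" assume "open U"
  then have "open (p -` U)" by (rule open_vimage[OF _ assms])
  moreover have "case_ecomplex (\<lambda>z. FinC (p z)) v -` (FinC ` U) \<inter> space ecomplex_borel
      = FinC ` (p -` U) \<union> ({InfC} \<inter> {_. v \<in> FinC ` U})" (is "?L = ?R")
  proof (rule set_eqI)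
    fix x show "x \<in> ?L \<longleftrightarrow> x \<in> ?R" by (cases x) auto
  qed
  ultimately show "case_ecomplex (\<lambda>z. FinC (p z)) v -` (FinC ` U) \<inter> space ecomplex_borel
      \<in> sets ecomplex_borel"
    using FinC_image_sets sets.Un[OF _ InfC_sets] by auto
qed

section \<open>Distribution functions and equidistribution of the rearrangement\<close>

abbreviation ec_dist :: "(real \<Rightarrow> ennreal) \<Rightarrow> real \<Rightarrow> ennreal" where
  "ec_dist G s \<equiv> emeasure halfline {x \<in> space halfline. G x > ennreal s}"

lemma rearr_cong:
  assumes "\<And>s. 0 \<le> s \<Longrightarrow> ec_dist (\<lambda>x. ec_abs (f x)) s = ec_dist (\<lambda>x. ec_abs (g x)) s"
  shows "rearr f t = rearr g t"
  unfolding rearr_def using assms by (intro arg_cong[where f = Inf]) auto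

text \<open>Right continuity of the distribution function, phrased as the transfer of an upper
  bound. The set where \<open>G\<close> exceeds \<open>s\<close> is the increasing union of the sets
  where it exceeds \<open>s + 1/(n+1)\<close>, and measures are continuous from below.\<close>

lemma ec_dist_right_continuous:
  assumes [measurable]: "G \<in> M_plus" and "0 \<le> s" and le: "\<And>r. s < r \<Longrightarrow> ec_dist G r \<le> m"
  shows "ec_dist G s \<le> m"
proof -
  define S where "S n = {x \<in> space halfline. G x > ennreal (s + 1 / real (Suc n))}" for n
  have S: "range S \<subseteq> sets halfline" unfolding S_def by (intro image_subsetI) measurable
  have "incseq S" unfolding S_def
  proof (rule incseq_SucI, safe)
    fix n x assume "ennreal (s + 1 / real (Suc n)) < G x"
    moreover have "ennreal (s + 1 / real (Suc (Suc n))) \<le> ennreal (s + 1 / real (Suc n))"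
      by (intro ennreal_leI add_left_mono divide_left_mono) auto
    ultimately show "ennreal (s + 1 / real (Suc (Suc n))) < G x" by (rule order_le_less_trans[rotated])
  qed
  have "{x \<in> space halfline. G x > ennreal s} = (\<Union>n. S n)"
  proof (intro subset_antisym subsetI)
    fix x assume x: "x \<in> {x \<in> space halfline. G x > ennreal s}"
    then obtain b where b: "ennreal s < b" "b < G x" using dense by blast
    then obtain r where r: "b = ennreal r" "0 \<le> r" by (cases b) auto
    then have "s < r" using b \<open>0 \<le> s\<close> by (auto simp: ennreal_less_iff)
    then obtain n where "1 / real (Suc n) < r - s"
      using reals_Archimedean[of "r - s"] by (auto simp: inverse_eq_divide)
    then have "ennreal (s + 1 / real (Suc n)) \<le> ennreal r" by (intro ennreal_leI) auto
    then have "ennreal (s + 1 / real (Suc n)) < G x" using b(2) r(1) by (metis order_le_less_trans)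
    then have "x \<in> S n" using x unfolding S_def by blast
    then show "x \<in> (\<Union>n. S n)" by auto
  next
    fix x assume "x \<in> (\<Union>n. S n)"
    then obtain n where n: "x \<in> space halfline" "ennreal (s + 1 / real (Suc n)) < G x"
      by (auto simp: S_def)
    have "ennreal s \<le> ennreal (s + 1 / real (Suc n))" by (intro ennreal_leI) auto
    then have "ennreal s < G x" using n(2) by (rule order_le_less_trans)
    then show "x \<in> {x \<in> space halfline. G x > ennreal s}" using n(1) by blast
  qed
  then have "ec_dist G s = (SUP n. emeasure halfline (S n))"
    using SUP_emeasure_incseq[OF S \<open>incseq S\<close>] by simp
  also have "\<dots> \<le> m" unfolding S_def by (intro SUP_least le) auto
  finally show ?thesis .
qed

text \<open>The infimum defining \<open>rearr f t\<close> is attained when finite: every level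
  strictly above \<open>s\<close> satisfies the measure bound, and right continuity carries the
  bound down to \<open>s\<close> itself.\<close>

lemma rearr_le_iff:
  assumes f: "f \<in> M_space" and "0 \<le> s"
  shows "rearr f t \<le> ennreal s \<longleftrightarrow> ec_dist (\<lambda>x. ec_abs (f x)) s \<le> ennreal t"
proof
  assume "ec_dist (\<lambda>x. ec_abs (f x)) s \<le> ennreal t"
  then show "rearr f t \<le> ennreal s"
    unfolding rearr_def using \<open>0 \<le> s\<close> by (intro Inf_lower) auto
next
  assume le: "rearr f t \<le> ennreal s"
  have [measurable]: "(\<lambda>x. ec_abs (f x)) \<in> M_plus" using f by (rule ec_abs_in_M_plus)
  show "ec_dist (\<lambda>x. ec_abs (f x)) s \<le> ennreal t"
  proof (rule ec_dist_right_continuous)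
    fix r assume "s < r"
    then have "rearr f t < ennreal r" using le \<open>0 \<le> s\<close>
      by (auto simp: ennreal_less_iff intro: order_le_less_trans)
    \<comment> \<open>An infimum below \<open>r\<close> means that some admissible level
      \<open>q\<close> lies below \<open>r\<close>; the distribution function is non-increasing, so
      \<open>r\<close> is admissible too.\<close>
    then obtain q where q: "0 \<le> q" "ec_dist (\<lambda>x. ec_abs (f x)) q \<le> ennreal t" "ennreal q < ennreal r"
      unfolding rearr_def Inf_less_iff by auto
    have "ec_dist (\<lambda>x. ec_abs (f x)) r \<le> ec_dist (\<lambda>x. ec_abs (f x)) q"
    proof (rule emeasure_mono)
      show "{x \<in> space halfline. ennreal r < ec_abs (f x)} \<subseteq> {x \<in> space halfline. ennreal q < ec_abs (f x)}"
        using q(3) less_trans by blast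
    qed measurable
    then show "ec_dist (\<lambda>x. ec_abs (f x)) r \<le> ennreal t" using q by auto
  qed (use \<open>0 \<le> s\<close> in auto)
qed

lemma rearr_antimono: "t \<le> u \<Longrightarrow> rearr f u \<le> rearr f t"
  unfolding rearr_def
proof (rule Inf_superset_mono, rule subsetI)
  fix a
  assume "t \<le> u" and "a \<in> {ennreal s |s::real. 0 \<le> s \<and> ec_dist (\<lambda>x. ec_abs (f x)) s \<le> ennreal t}"
  then obtain s where "a = ennreal s" "0 \<le> s" "ec_dist (\<lambda>x. ec_abs (f x)) s \<le> ennreal u"
    using ennreal_leI[of t u] order_trans by blast
  then show "a \<in> {ennreal s |s::real. 0 \<le> s \<and> ec_dist (\<lambda>x. ec_abs (f x)) s \<le> ennreal u}"
    by blast
qed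

text \<open>Taken with \<open>m\<close> the measure of a superlevel set of |f|: the superlevel sets
  of the rearrangement turn out to be exactly such initial segments, which yields both its
  measurability and its distribution.\<close>

lemma
  fixes m :: ennreal
  shows halfline_initial_segment_sets: "{t \<in> space halfline. ennreal t < m} \<in> sets halfline"
    and emeasure_halfline_initial_segment: "emeasure halfline {t \<in> space halfline. ennreal t < m} = m"
proof -
  have "{t \<in> space halfline. ennreal t < m} \<in> sets halfline
    \<and> emeasure halfline {t \<in> space halfline. ennreal t < m} = m"
  proof (cases m)
    case (real r)
    have "{t \<in> space halfline. ennreal t < m} = {0..<r}"
      by (auto simp: real space_restrict_space ennreal_less_iff)
    moreover have "{0..<r} \<subseteq> {0..}" by auto
    ultimately show ?thesis
      using real by (simp add: sets_restrict_space_iff emeasure_restrict_space)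
  next
    case top
    have "{t \<in> space halfline. ennreal t < m} = {0..}"
      by (auto simp: top space_restrict_space)
    moreover have "emeasure lebesgue {0::real..} = \<infinity>"
    proof (rule ccontr)
      assume "emeasure lebesgue {0::real..} \<noteq> \<infinity>"
      then obtain r where r: "emeasure lebesgue {0::real..} = ennreal r" "0 \<le> r"
        by (cases "emeasure lebesgue {0::real..}") auto
      have "emeasure lebesgue {0..r + 1} \<le> emeasure lebesgue {0::real..}"
        by (intro emeasure_mono) auto
      then show False using r by (simp add: ennreal_le_iff)
    qed
    ultimately show ?thesis
      by (simp add: top sets_restrict_space_iff emeasure_restrict_space)
  qed
  then show "{t \<in> space halfline. ennreal t < m} \<in> sets halfline"
    and "emeasure halfline {t \<in> space halfline. ennreal t < m} = m" by auto
qed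

lemma rearr_greater_set:
  assumes "f \<in> M_space" and "0 \<le> s"
  shows "{t \<in> space halfline. rearr f t > ennreal s}
    = {t \<in> space halfline. ennreal t < ec_dist (\<lambda>x. ec_abs (f x)) s}"
  using rearr_le_iff[OF assms] by (auto simp: not_le[symmetric])

lemma rearr_in_M_plus:
  assumes "f \<in> M_space"
  shows "rearr f \<in> M_plus"
proof (rule borel_measurableI_greater)
  fix a :: ennreal
  show "{t \<in> space halfline. a < rearr f t} \<in> sets halfline"
  proof (cases a)
    case (real r)
    then show ?thesis
      using rearr_greater_set[OF assms] halfline_initial_segment_sets by simp
  qed simp
qed

lemma ec_dist_rearr:
  assumes "f \<in> M_space" and "0 \<le> s"
  shows "ec_dist (rearr f) s = ec_dist (\<lambda>x. ec_abs (f x)) s"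
  unfolding rearr_greater_set[OF assms] by (rule emeasure_halfline_initial_segment)

section \<open>Consequences of the axioms for a rearrangement-invariant norm\<close>

context
  fixes N :: "(real \<Rightarrow> ecomplex) \<Rightarrow> ennreal"
  assumes N: "ri_banach_function_norm N"
begin

lemma norm_is_bfn: "banach_function_norm N"
  using N unfolding ri_banach_function_norm_def by (rule conjunct1)

lemmas norm_axioms = norm_is_bfn[unfolded banach_function_norm_def]

lemma norm_ec_abs: "f \<in> M_space \<Longrightarrow> N (nonneg_emb (\<lambda>x. ec_abs (f x))) = N f"
  using norm_axioms[THEN conjunct1] by blast

lemma norm_scale:
  "f \<in> M_plus \<Longrightarrow> 0 \<le> a \<Longrightarrow> N (nonneg_emb (\<lambda>x. ennreal a * f x)) = ennreal a * N (nonneg_emb f)"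
  using norm_axioms[THEN conjunct2, THEN conjunct1] by blast

lemma norm_add:
  "f \<in> M_plus \<Longrightarrow> g \<in> M_plus \<Longrightarrow>
    N (nonneg_emb (\<lambda>x. f x + g x)) \<le> N (nonneg_emb f) + N (nonneg_emb g)"
  using norm_axioms[THEN conjunct2, THEN conjunct2, THEN conjunct2, THEN conjunct1] by blast

lemma norm_mono:
  assumes "f \<in> M_plus" "g \<in> M_plus" "\<And>x. 0 \<le> x \<Longrightarrow> f x \<le> g x"
  shows "N (nonneg_emb f) \<le> N (nonneg_emb g)"
proof -
  have "AE x in halfline. f x \<le> g x"
    using assms(3) by (intro AE_I2) (auto simp: space_restrict_space)
  then show ?thesis
    using norm_axioms[THEN conjunct2, THEN conjunct2, THEN conjunct2, THEN conjunct2, THEN conjunct1] assms(1,2)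
    by blast
qed

lemma norm_indicator_finite:
  "E \<in> sets halfline \<Longrightarrow> emeasure halfline E < \<infinity> \<Longrightarrow> N (nonneg_emb (indicator E)) < \<infinity>"
  using norm_axioms[THEN conjunct2, THEN conjunct2, THEN conjunct2, THEN conjunct2,
      THEN conjunct2, THEN conjunct2, THEN conjunct1]
  by blast

lemma norm_integral_bound:
  assumes "E \<in> sets halfline" "emeasure halfline E < \<infinity>"
  obtains C where "C < \<infinity>" "\<And>f. f \<in> M_plus \<Longrightarrow> (\<integral>\<^sup>+x\<in>E. f x \<partial>halfline) \<le> C * N (nonneg_emb f)"
proof -
  have "\<exists>C<\<infinity>. \<forall>f\<in>M_plus. (\<integral>\<^sup>+x\<in>E. f x \<partial>halfline) \<le> C * N (nonneg_emb f)"
    using norm_axioms[THEN conjunct2, THEN conjunct2, THEN conjunct2, THEN conjunct2,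
        THEN conjunct2, THEN conjunct2, THEN conjunct2] assms
    by blast
  then show ?thesis using that by blast
qed

text \<open>The rearrangement is determined by the distribution function alone, so rearrangement
  invariance can be applied without computing any rearrangement. It serves for
  \<open>rearr f\<close> and for both pieces of the cut.\<close>

lemma norm_equidistributed:
  assumes "f \<in> M_plus" "g \<in> M_plus" "\<And>s. 0 \<le> s \<Longrightarrow> ec_dist f s = ec_dist g s"
  shows "N (nonneg_emb f) = N (nonneg_emb g)"
proof -
  have "rearr (nonneg_emb f) t = rearr (nonneg_emb g) t" for t
    using assms(3) by (intro rearr_cong) simp
  then show ?thesis
    using N nonneg_emb_in_M_space assms(1,2) unfolding ri_banach_function_norm_def by blast
qed

lemma norm_rearr:
  assumes "f \<in> M_space"
  shows "N (nonneg_emb (rearr f)) = N f"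
  using norm_equidistributed[OF rearr_in_M_plus[OF assms] ec_abs_in_M_plus[OF assms] ec_dist_rearr[OF assms]]
    norm_ec_abs[OF assms] by simp

lemma norm_rearr_restrict:
  assumes "f \<in> M_space" "I \<in> sets borel"
  shows "N (nonneg_emb (\<lambda>t. rearr f t * indicator I t)) \<le> N f"
proof -
  note [measurable] = rearr_in_M_plus[OF assms(1)] indicator_in_M_plus[OF assms(2)]
  have "N (nonneg_emb (\<lambda>t. rearr f t * indicator I t)) \<le> N (nonneg_emb (rearr f))"
    by (intro norm_mono) (measurable, auto simp: indicator_def)
  then show ?thesis by (simp add: norm_rearr assms)
qed

end

section \<open>The embedding of the intersection\<close>

lemma inter_embedded_WL:
  assumes A: "ri_banach_function_norm A" and B: "ri_banach_function_norm B"
  shows "cont_embedded (fspace A \<inter> fspace B) (inter_norm A B) (fspace (WL_norm A B)) (WL_norm A B)"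
proof -
  have le: "WL_norm A B f \<le> 2 * inter_norm A B f" if "f \<in> M_space" for f
  proof -
    have "WL_norm A B f \<le> A f + B f"
      unfolding WL_norm_def using that
      by (intro add_mono norm_rearr_restrict[OF A] norm_rearr_restrict[OF B]) auto
    also have "\<dots> \<le> inter_norm A B f + inter_norm A B f"
      unfolding inter_norm_def by (intro add_mono) auto
    finally show ?thesis by (simp add: mult_2)
  qed
  have "f \<in> fspace (WL_norm A B)" if "f \<in> fspace A \<inter> fspace B" for f
  proof -
    have "2 * inter_norm A B f < \<infinity>" "f \<in> M_space"
      using that by (auto simp: fspace_def inter_norm_def ennreal_mult_less_top max_def)
    then show ?thesis using le[of f] by (auto simp: fspace_def)
  qed
  moreover have "\<forall>f\<in>fspace A \<inter> fspace B. WL_norm A B f \<le> 2 * inter_norm A B f"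
    using le by (auto simp: fspace_def)
  ultimately show ?thesis unfolding cont_embedded_def
    by (intro conjI exI[of _ 2]) auto
qed

section \<open>Cutting a function at a height\<close>

definition truncate :: "real \<Rightarrow> complex \<Rightarrow> complex" where
  "truncate c z = complex_of_real (c / max c (cmod z)) * z"

text \<open>For \<open>c > 0\<close> the maximum keeps the denominator away from 0, including at
  \<open>z = 0\<close>. For \<open>c = 0\<close> the numerator makes the factor 0 everywhere, also
  at \<open>z = 0\<close>, where the quotient 0/0 is 0 by convention.\<close>

lemma continuous_truncate:
  assumes "0 \<le> c"
  shows "continuous_on UNIV (truncate c)"
proof (cases "c = 0")
  case True
  then show ?thesis by (simp add: truncate_def[abs_def])
next
  case False
  then have "max c (cmod z) \<noteq> 0" for z using assms by (auto simp: max_def)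
  then show ?thesis unfolding truncate_def by (intro continuous_intros) auto
qed

lemma cmod_truncate:
  assumes "0 \<le> c"
  shows "cmod (truncate c z) = min (cmod z) c"
  using assms by (auto simp: truncate_def norm_mult norm_divide max_def min_def)

text \<open>Truncation multiplies \<open>z\<close> by a real factor \<open>r \<le> 1\<close>, so the
  remainder is \<open>z\<close> times the non-negative number \<open>1 - r\<close>, and the moduli
  of the two parts add up to that of \<open>z\<close>.\<close>

lemma cmod_minus_truncate:
  assumes "0 \<le> c"
  shows "cmod (z - truncate c z) = max 0 (cmod z - c)"
proof -
  define r where "r = c / max c (cmod z)"
  have "z - truncate c z = complex_of_real (1 - r) * z"
    by (simp add: truncate_def r_def algebra_simps)
  then have "cmod (z - truncate c z) = \<bar>1 - r\<bar> * cmod z"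
    by (simp only: norm_mult norm_of_real)
  moreover have "r \<le> 1" using assms by (auto simp: r_def max_def divide_le_eq)
  moreover have "r * cmod z = min (cmod z) c"
    using assms by (auto simp: r_def max_def min_def)
  ultimately show ?thesis by (auto simp: left_diff_distrib max_def min_def)
qed

text \<open>The infinite value goes to the unbounded part, so that the two parts
  add up to \<open>f\<close> everywhere and no finiteness almost everywhere has to be established.\<close>

lemma split_at_height:
  assumes f: "f \<in> M_space" and "0 \<le> c"
  obtains g h where "g \<in> M_space" "h \<in> M_space" "\<And>x. ec_add (g x) (h x) = f x"
    "\<And>x. ec_abs (g x) = ec_abs (f x) - ennreal c" "\<And>x. ec_abs (h x) = min (ec_abs (f x)) (ennreal c)"
proof
  let ?g = "case_ecomplex (\<lambda>z. FinC (z - truncate c z)) InfC"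
  let ?h = "case_ecomplex (\<lambda>z. FinC (truncate c z)) (FinC (complex_of_real c))"
  note cont = continuous_truncate[OF \<open>0 \<le> c\<close>]
  show "(\<lambda>x. ?g (f x)) \<in> M_space" "(\<lambda>x. ?h (f x)) \<in> M_space"
    using f unfolding M_space_def
    by (auto intro!: measurable_compose[OF _ measurable_case_ecomplex_continuous]
        continuous_on_diff continuous_on_id cont)
  show "ec_add (?g (f x)) (?h (f x)) = f x" for x by (cases "f x") auto
  show "ec_abs (?g (f x)) = ec_abs (f x) - ennreal c" for x
    using \<open>0 \<le> c\<close>
    by (cases "f x") (auto simp: cmod_minus_truncate ennreal_minus max_def ennreal_neg)
  show "ec_abs (?h (f x)) = min (ec_abs (f x)) (ennreal c)" for x
    using \<open>0 \<le> c\<close>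
    by (cases "f x") (auto simp: cmod_truncate min_def ennreal_le_iff top_unique)
qed

section \<open>The embedding into the sum\<close>

lemma ec_dist_diff:
  assumes "0 \<le> s" "0 \<le> c"
  shows "ec_dist (\<lambda>x. G x - ennreal c) s = ec_dist G (s + c)"
proof -
  have "ennreal s < y - ennreal c \<longleftrightarrow> ennreal (s + c) < y" for y
    using assms by (cases y) (auto simp: ennreal_minus ennreal_less_iff simp del: ennreal_plus)
  then show ?thesis by simp
qed

lemma ec_dist_min:
  "ec_dist (\<lambda>x. min (G x) c) s = (if ennreal s < c then ec_dist G s else 0)"
  by simp

lemma WL_embedded_sum:
  assumes A: "ri_banach_function_norm A" and B: "ri_banach_function_norm B"
  shows "cont_embedded (fspace (WL_norm A B)) (WL_norm A B) (sum_space A B) (sum_norm A B)"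
proof -
  have I: "{0..1} \<in> sets halfline" "emeasure halfline {0..1} = 1"
    by (auto simp: sets_restrict_space_iff emeasure_restrict_space)
  obtain C where C: "C < \<infinity>"
    "\<And>f. f \<in> M_plus \<Longrightarrow> (\<integral>\<^sup>+x\<in>{0..1}. f x \<partial>halfline) \<le> C * A (nonneg_emb f)"
    using norm_integral_bound[OF A I(1)] I(2) by auto
  define b where "b = B (nonneg_emb (indicator {0..1}))"
  have b: "b < \<infinity>" unfolding b_def using norm_indicator_finite[OF B I(1)] I(2) by auto
  \<comment> \<open>Chosen so that \<open>K * (a1 + b1)\<close> dominates
    \<open>a1 + C * a1 * b + b1\<close>, the bound obtained below for the two pieces
    together.\<close>
  define K where "K = 1 + C * b"
  have K: "K < \<infinity>" using C b by (auto simp: K_def ennreal_mult_less_top)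
  have main: "\<exists>g\<in>fspace A. \<exists>h\<in>fspace B. (\<forall>x. ec_add (g x) (h x) = f x) \<and> A g + B h \<le> K * WL_norm A B f"
    if "f \<in> fspace (WL_norm A B)" for f
  proof -
    have f: "f \<in> M_space" and fin: "WL_norm A B f < \<infinity>" using that by (auto simp: fspace_def)
    note [measurable] = rearr_in_M_plus[OF f] indicator_in_M_plus[of "{0..1}"] indicator_in_M_plus[of "{1<..}"]
    define a1 where "a1 = A (nonneg_emb (\<lambda>t. rearr f t * indicator {0..1} t))"
    define b1 where "b1 = B (nonneg_emb (\<lambda>t. rearr f t * indicator {1<..} t))"
    have WL: "WL_norm A B f = a1 + b1" by (simp add: WL_norm_def a1_def b1_def)
    have m1: "(\<lambda>t. rearr f t * indicator {0..1} t) \<in> M_plus"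
      "(\<lambda>t. rearr f t * indicator {1<..} t) \<in> M_plus"
      "(indicator {0..1} :: real \<Rightarrow> ennreal) \<in> M_plus"
      by (measurable; simp)+
    \<comment> \<open>The interval has measure 1, and on it the non-increasing rearrangement is at
      least its value at 1.\<close>
    have "rearr f 1 = (\<integral>\<^sup>+x. rearr f 1 * indicator {0..1} x \<partial>halfline)"
      using I by (simp add: nn_integral_cmult_indicator)
    also have "\<dots> \<le> (\<integral>\<^sup>+x\<in>{0..1}. (rearr f x * indicator {0..1} x) \<partial>halfline)"
      by (intro nn_integral_mono) (auto simp: indicator_def intro: rearr_antimono)
    also have "\<dots> \<le> C * a1" unfolding a1_def by (intro C m1)
    finally have r1: "rearr f 1 \<le> C * a1" .
    \<comment> \<open>Finiteness makes \<open>rearr f 1\<close> a real number \<open>c\<close>,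
      which can then serve as the cutting height.\<close>
    also have "\<dots> < \<infinity>" using C fin by (auto simp: WL ennreal_mult_less_top)
    finally obtain c where c: "rearr f 1 = ennreal c" "0 \<le> c" by (cases "rearr f 1") auto
    obtain g h where gh: "g \<in> M_space" "h \<in> M_space" "\<And>x. ec_add (g x) (h x) = f x"
      "\<And>x. ec_abs (g x) = ec_abs (f x) - ennreal c" "\<And>x. ec_abs (h x) = min (ec_abs (f x)) (ennreal c)"
      using split_at_height[OF f c(2)] by metis
    have "A g = A (nonneg_emb (\<lambda>x. ec_abs (g x)))" using norm_ec_abs[OF A gh(1)] by simp
    also have "\<dots> = A (nonneg_emb (\<lambda>t. rearr f t - ennreal c))"
    proof (rule norm_equidistributed[OF A ec_abs_in_M_plus[OF gh(1)]])
      fix s :: real assume "0 \<le> s"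
      then show "ec_dist (\<lambda>x. ec_abs (g x)) s = ec_dist (\<lambda>t. rearr f t - ennreal c) s"
        \<comment> \<open>Both sides become distribution functions at the shifted level
          \<open>s + c\<close>, where |f| and its rearrangement agree.\<close>
        unfolding gh(4) ec_dist_diff[OF \<open>0 \<le> s\<close> c(2)] using c(2) by (simp only: ec_dist_rearr[OF f] add_nonneg_nonneg)
    qed measurable
    also have "\<dots> \<le> a1" unfolding a1_def
    proof (rule norm_mono[OF A _ m1(1)])
      fix t :: real assume "0 \<le> t"
      then show "rearr f t - ennreal c \<le> rearr f t * indicator {0..1} t"
        \<comment> \<open>Beyond 1 the rearrangement is at most \<open>c\<close>, so the truncated
          difference is 0; up to 1 the subtraction is simply dropped.\<close>
        using rearr_antimono[of 1 t f] c
        by (cases "t \<le> 1") (auto simp: diff_le_self_ennreal diff_eq_0_iff_ennreal intro: le_less_trans)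
    qed measurable
    finally have Ag: "A g \<le> a1" .
    have "B h = B (nonneg_emb (\<lambda>x. ec_abs (h x)))" using norm_ec_abs[OF B gh(2)] by simp
    also have "\<dots> = B (nonneg_emb (\<lambda>t. min (rearr f t) (ennreal c)))"
    proof (rule norm_equidistributed[OF B ec_abs_in_M_plus[OF gh(2)]])
      fix s :: real assume "0 \<le> s"
      then show "ec_dist (\<lambda>x. ec_abs (h x)) s = ec_dist (\<lambda>t. min (rearr f t) (ennreal c)) s"
        unfolding gh(5) ec_dist_min using ec_dist_rearr[OF f] by simp
    qed measurable
    \<comment> \<open>The minimum is bounded by its constant argument on [0,1] and by its other
      argument beyond 1.\<close>
    also have "\<dots> \<le> B (nonneg_emb (\<lambda>t. ennreal c * indicator {0..1} t + rearr f t * indicator {1<..} t))"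
      by (intro norm_mono[OF B]) (measurable, auto simp: indicator_def)
    also have "\<dots> \<le> B (nonneg_emb (\<lambda>t. ennreal c * indicator {0..1} t)) + b1"
      unfolding b1_def by (intro norm_add[OF B] m1) measurable
    also have "\<dots> = ennreal c * b + b1"
      unfolding b_def using norm_scale[OF B m1(3) c(2)] by simp
    also have "\<dots> \<le> C * a1 * b + b1" using r1 c by (intro add_mono mult_right_mono) auto
    finally have Bh: "B h \<le> C * a1 * b + b1" .
    have "A g + B h \<le> a1 + (C * a1 * b + b1)" using Ag Bh by (rule add_mono)
    \<comment> \<open>The added term is the one missing from the expansion of
      \<open>(1 + C * b) * (a1 + b1)\<close>.\<close>
    also have "\<dots> \<le> a1 + (C * a1 * b + b1) + C * b * b1" by simp
    also have "\<dots> = K * WL_norm A B f" unfolding K_def WL by (simp add: algebra_simps)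
    finally have bound: "A g + B h \<le> K * WL_norm A B f" .
    \<comment> \<open>The norm estimate itself shows that the pieces lie in the two spaces, since a
      finite sum has finite terms.\<close>
    also have "\<dots> < \<infinity>" using K fin by (simp add: ennreal_mult_less_top)
    finally have "g \<in> fspace A" "h \<in> fspace B" using gh by (auto simp: fspace_def)
    then show ?thesis using bound gh(3) by blast
  qed
  have "fspace (WL_norm A B) \<subseteq> sum_space A B"
  proof
    fix f assume f: "f \<in> fspace (WL_norm A B)"
    then obtain g h where "g \<in> fspace A" "h \<in> fspace B" "\<And>x. ec_add (g x) (h x) = f x"
      using main by blast
    then show "f \<in> sum_space A B" using f unfolding sum_space_def fspace_def[of "WL_norm A B"] by auto
  qed
  moreover have "sum_norm A B f \<le> K * WL_norm A B f" if f: "f \<in> fspace (WL_norm A B)" for f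
  proof -
    obtain g h where gh: "g \<in> fspace A" "h \<in> fspace B" "\<And>x. ec_add (g x) (h x) = f x"
      "A g + B h \<le> K * WL_norm A B f"
      using main[OF f] by blast
    then have "sum_norm A B f \<le> A g + B h"
      unfolding sum_norm_def by (intro Inf_lower) auto
    then show ?thesis using gh(4) by (rule order_trans)
  qed
  ultimately show ?thesis unfolding cont_embedded_def using K by blast
qed

theorem theorem3p11:
  fixes A B :: "(real \<Rightarrow> ecomplex) \<Rightarrow> ennreal"
  assumes "ri_banach_function_norm A" and "ri_banach_function_norm B"
  shows "cont_embedded (fspace A \<inter> fspace B) (inter_norm A B) (fspace (WL_norm A B)) (WL_norm A B)
    \<and> cont_embedded (fspace (WL_norm A B)) (WL_norm A B) (sum_space A B) (sum_norm A B)"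
  using inter_embedded_WL[OF assms] WL_embedded_sum[OF assms] by blast

end
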